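(* For every integer $k\ge 3$, \[\overline{\alpha}(\{1,k,k+3\})=\begin{cases}\frac{2k+5}{5k+20} & k\equiv 0\pmod 5,\\ \frac25 & k\equiv 1\pmod 5,\\ \frac{2k+6}{5k+20} & k\equiv 2\pmod 5,\\ \frac{4k+3}{10k+15} & k\equiv 3\pmod 5,\\ \frac{2k+7}{5k+20} & k\equiv 4\pmod 5.\end{cases}\]
   Context: For a finite set $S$ of positive integers, the distance graph $G(S)$ has vertex set $\mathbb{Z}$, with $i,j$ adjacent iff $|i-j|\in S$. The density of $A\subseteq\mathbb{Z}$ is $\delta(A)=\limsup_{N\to\infty}\frac{|A\cap[-N,N]|}{2N+1}$, and the independence ratio $\overline{\alpha}(S)$ is the supremum of $\delta(A)$ over independent sets $A$ of $G(S)$. *)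

theory Defs
  imports "HOL-Analysis.Analysis"
begin

definition dist_adj :: "nat set \<Rightarrow> int \<Rightarrow> int \<Rightarrow> bool" where
  "dist_adj S i j \<longleftrightarrow> nat \<bar>i - j\<bar> \<in> S"

definition independent_dist :: "nat set \<Rightarrow> int set \<Rightarrow> bool" where
  "independent_dist S A \<longleftrightarrow> (\<forall>i\<in>A. \<forall>j\<in>A. \<not> dist_adj S i j)"

definition upper_density :: "int set \<Rightarrow> ereal" where
  "upper_density A = limsup (\<lambda>N::nat. ereal (real (card (A \<inter> {-int N..int N})) / real (2*N+1)))"

definition indep_ratio :: "nat set \<Rightarrow> ereal" where
  "indep_ratio S = (SUP A\<in>{A. independent_dist S A}. upper_density A)"

end

theory Submission
  imports Defs
begin

text \<open>
  Upper bound: for every \<open>n\<close> the vertices \<open>n, n + 1, n + 2, n + 3, n + k + 3\<close> form a five-cycle.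
  Write \<open>S n\<close> for the number of elements of \<open>A\<close> in the window of length \<open>k + 4\<close> starting at \<open>n\<close>.
  Adding up the five-cycles that start in such a window, read cyclically, gives
  \<open>4 S n + S (n + k) \<le> 2 (k + 4)\<close>. Let \<open>2 (k + 4) = 5 c + r\<close>. If \<open>r \<le> 3\<close>, an excess of \<open>S n\<close>
  over \<open>c\<close> is an integer and hence forces at least the same defect of \<open>S (n + k)\<close>, so that the mean
  of \<open>S\<close> is at most \<open>c\<close>. The remaining case \<open>r = 4\<close> is \<open>k = 5 m + 3\<close>; here every window of length
  \<open>2 k + 3\<close> has at most \<open>4 m + 3\<close> elements, by a similar summation modulo \<open>2 k + 3\<close>.

  That sum is too weak by one only if \<open>0\<close>, \<open>k + 1\<close>, \<open>2 k + 2\<close> all lie in \<open>A\<close>, and then the inequality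
  for \<open>S\<close> and its mirror image are both strict.

  Lower bound: periodic sets of period \<open>k + 4\<close> or \<open>2 k + 3\<close> whose consecutive gaps alternate
  between 2 and 3 up to a few exceptions.
\<close>

section \<open>Sums over integer intervals\<close>

lemma sum_atLeastLessThan_shift_int:
  fixes f :: "int \<Rightarrow> 'a::comm_monoid_add"
  shows "(\<Sum>i\<in>{a..<b}. f (i + j)) = sum f {a + j..<b + j}"
  by (rule sum.reindex_bij_witness[of _ "\<lambda>i. i - j" "\<lambda>i. i + j"]) auto

text \<open>The discrete antiderivative vanishing at \<open>0\<close>; one of the two sums is always
  empty. Interval sums become differences of its values, so overlapping windows can be compared by
  linear arithmetic.\<close>

definition antidiff :: "(int \<Rightarrow> int) \<Rightarrow> int \<Rightarrow> int" where
  "antidiff f b = sum f {0..<b} - sum f {b..<0}"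

lemma antidiff_Suc: "antidiff f (n + 1) = antidiff f n + f n"
proof (cases "n \<ge> 0")
  case True
  then have "{0..<n + 1} = insert n {0..<n}" "{n + 1..<0} = {}" "{n..<0} = {}" by auto
  then show ?thesis by (simp add: antidiff_def)
next
  case False
  then have "{n..<0} = insert n {n + 1..<0}" "{0..<n + 1} = {}" "{0..<n} = {}" by auto
  then show ?thesis by (simp add: antidiff_def)
qed

lemma antidiff_step: "n = m + 1 \<Longrightarrow> antidiff f n = antidiff f m + f m"
  by (simp add: antidiff_Suc)

lemma sum_eq_antidiff:
  assumes "a \<le> b"
  shows "sum f {a..<b} = antidiff f b - antidiff f a"
  using assms
proof (induction b rule: int_ge_induct)
  case (step b)
  then have "{a..<b + 1} = insert b {a..<b}" by auto
  with step show ?case by (simp add: antidiff_Suc)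
qed simp

text \<open>Moving an interval by one step trades one end value for another, which changes the sum
  by at most \<open>C\<close>.\<close>

lemma sum_shift_diff_bound:
  fixes \<phi> :: "int \<Rightarrow> int"
  assumes "\<And>n. 0 \<le> \<phi> n" "\<And>n. \<phi> n \<le> C" "a \<le> b"
  shows "\<bar>\<Sum>n\<in>{a..<b}. \<phi> (n + int j) - \<phi> n\<bar> \<le> C * int j"
proof (induction j)
  case (Suc j)
  have "(\<Sum>n\<in>{a..<b}. \<phi> (n + int (Suc j))) = sum \<phi> {a + int j + 1..<b + int j + 1}"
    by (subst sum_atLeastLessThan_shift_int) (simp add: algebra_simps)
  also have "\<dots> = sum \<phi> {a + int j..<b + int j} + \<phi> (b + int j) - \<phi> (a + int j)"
    using assms(3) by (simp add: sum_eq_antidiff antidiff_Suc)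
  also have "sum \<phi> {a + int j..<b + int j} = (\<Sum>n\<in>{a..<b}. \<phi> (n + int j))"
    by (simp add: sum_atLeastLessThan_shift_int)
  finally have "(\<Sum>n\<in>{a..<b}. \<phi> (n + int (Suc j)) - \<phi> n) =
      (\<Sum>n\<in>{a..<b}. \<phi> (n + int j) - \<phi> n) + (\<phi> (b + int j) - \<phi> (a + int j))"
    by (simp add: sum_subtractf)
  moreover have "\<bar>\<phi> (b + int j) - \<phi> (a + int j)\<bar> \<le> C"
    using assms(1,2)[of "b + int j"] assms(1,2)[of "a + int j"] by linarith
  ultimately show ?case using Suc.IH by (simp add: algebra_simps)
qed simp

text \<open>Double counting: the window sums add up \<open>w\<close> shifted copies of
  \<open>f\<close>, and each copy differs from \<open>f\<close> on \<open>{a..<b}\<close> only near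
  the ends.\<close>

lemma window_sum_bound:
  fixes f :: "int \<Rightarrow> int"
  assumes "\<And>n. 0 \<le> f n" "\<And>n. f n \<le> 1" "a \<le> b"
  shows "\<bar>(\<Sum>n\<in>{a..<b}. sum f {n..<n + int w}) - int w * sum f {a..<b}\<bar> \<le> int w * int w"
proof -
  have w: "sum f {n..<n + int w} = (\<Sum>j<w. f (n + int j))" for n
    by (rule sum.reindex_bij_witness[of _ "\<lambda>j. n + int j" "\<lambda>i. nat (i - n)"]) auto
  have "(\<Sum>n\<in>{a..<b}. sum f {n..<n + int w}) - int w * sum f {a..<b} =
      (\<Sum>j<w. \<Sum>n\<in>{a..<b}. f (n + int j) - f n)"
    unfolding w by (subst sum.swap) (simp add: sum_subtractf)
  also have "\<bar>\<dots>\<bar> \<le> (\<Sum>j<w. \<bar>\<Sum>n\<in>{a..<b}. f (n + int j) - f n\<bar>)"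
    by (rule sum_abs)
  also have "\<dots> \<le> (\<Sum>j<w. int w)"
  proof (rule sum_mono)
    fix j assume "j \<in> {..<w}"
    then show "\<bar>\<Sum>n\<in>{a..<b}. f (n + int j) - f n\<bar> \<le> int w"
      using sum_shift_diff_bound[of f 1 a b j] assms by fastforce
  qed
  finally show ?thesis by simp
qed

section \<open>Window counts and upper density\<close>

abbreviation ind :: "int set \<Rightarrow> int \<Rightarrow> int" where
  "ind A \<equiv> \<lambda>i. of_bool (i \<in> A)"

lemma card_eq_sum_ind:
  "int (card (A \<inter> {a..<b})) = sum (ind A) {a..<b}"
  by (simp add: sum.If_cases of_bool_def Int_def conj_commute)

lemma affine_ratio_tendsto:
  "(\<lambda>N::nat. ereal (x + y / real (2 * N + 1))) \<longlonglongrightarrow> ereal x"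
proof -
  have "filterlim (\<lambda>N::nat. real (2 * N + 1)) at_top sequentially"
    by (rule filterlim_compose[OF filterlim_real_sequentially filterlim_subseq]) (auto simp: strict_mono_def)
  then have "(\<lambda>N::nat. x + y / real (2 * N + 1)) \<longlonglongrightarrow> x + 0"
    by (intro tendsto_intros tendsto_divide_0[OF tendsto_const] filterlim_at_top_imp_at_infinity)
  then show ?thesis by simp
qed

lemma divide_affine:
  fixes w d :: real
  assumes "w > 0" "d > 0"
  shows "w * x \<le> c * d + B \<Longrightarrow> x / d \<le> c / w + (B / w) / d"
    and "c * d + B \<le> w * x \<Longrightarrow> c / w + (B / w) / d \<le> x / d"
proof -
  have "c / w + (B / w) / d = ((c * d + B) / w) / d" using assms by (simp add: add_divide_distrib)
  then show "w * x \<le> c * d + B \<Longrightarrow> x / d \<le> c / w + (B / w) / d"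
    and "c * d + B \<le> w * x \<Longrightarrow> c / w + (B / w) / d \<le> x / d"
    using assms by (simp_all only: divide_le_cancel divide_right_mono pos_le_divide_eq pos_divide_le_eq mult.commute)
      (simp_all add: mult.commute)
qed

text \<open>The differences of \<open>\<phi>\<close> telescope along steps of \<open>k\<close> and
  contribute only a bounded error. A window may thus exceed \<open>c\<close> if another one repays
  it.\<close>

lemma upper_density_le:
  fixes \<phi> :: "int \<Rightarrow> int"
  assumes "w > 0" "\<And>n. 0 \<le> \<phi> n" "\<And>n. \<phi> n \<le> C"
    and win: "\<And>n. sum (ind A) {n..<n + int w} \<le> c + \<phi> (n + int k) - \<phi> n"
  shows "upper_density A \<le> ereal (real_of_int c / real w)"
proof -
  \<comment> \<open>The boundary errors of the shift of \<open>\<phi>\<close> and of the double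
    counting; neither depends on \<open>N\<close>.\<close>
  define B where "B = C * int k + int w * int w"
  have bound: "real (card (A \<inter> {- int N..int N})) / real (2 * N + 1) \<le>
      real_of_int c / real w + (real_of_int B / real w) / real (2 * N + 1)" for N :: nat
  proof -
    define a b where "a = - int N" and "b = int N + 1"
    have ab: "a \<le> b" "b - a = 2 * int N + 1" by (simp_all add: a_def b_def)
    have "int w * sum (ind A) {a..<b} \<le> (\<Sum>n\<in>{a..<b}. sum (ind A) {n..<n + int w}) + int w * int w"
      using window_sum_bound[of "ind A" a b w] ab by fastforce
    also have "(\<Sum>n\<in>{a..<b}. sum (ind A) {n..<n + int w}) \<le> (\<Sum>n\<in>{a..<b}. c + (\<phi> (n + int k) - \<phi> n))"
      using win by (intro sum_mono) (simp add: algebra_simps)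
    also have "\<dots> = c * (2 * int N + 1) + (\<Sum>n\<in>{a..<b}. \<phi> (n + int k) - \<phi> n)"
      using ab by (subst sum.distrib) simp
    also have "\<dots> \<le> c * (2 * int N + 1) + C * int k"
      using sum_shift_diff_bound[of \<phi> C a b k] assms ab by fastforce
    finally have "int w * int (card (A \<inter> {a..<b})) \<le> c * (2 * int N + 1) + B"
      by (simp add: B_def card_eq_sum_ind)
    moreover have "{a..<b} = {- int N..int N}" by (auto simp: a_def b_def)
    ultimately have "int w * int (card (A \<inter> {- int N..int N})) \<le> c * (2 * int N + 1) + B" by simp
    then have "real_of_int (int w * int (card (A \<inter> {- int N..int N}))) \<le> real_of_int (c * (2 * int N + 1) + B)"
      by (simp only: of_int_le_iff)
    then have h: "real w * real (card (A \<inter> {- int N..int N})) \<le> real_of_int c * real (2 * N + 1) + real_of_int B"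
      by (simp add: algebra_simps)
    show ?thesis by (rule divide_affine(1)[OF _ _ h]) (use \<open>w > 0\<close> in simp_all)
  qed
  have "upper_density A \<le> limsup (\<lambda>N. ereal (real_of_int c / real w + (real_of_int B / real w) / real (2 * N + 1)))"
    unfolding upper_density_def by (rule Limsup_mono) (use bound in auto)
  also have "\<dots> = ereal (real_of_int c / real w)"
    by (rule lim_imp_Limsup) (simp, rule affine_ratio_tendsto)
  finally show ?thesis .
qed

lemma upper_density_ge:
  assumes "w > 0" and win: "\<And>n. c \<le> sum (ind A) {n..<n + int w}"
  shows "ereal (real_of_int c / real w) \<le> upper_density A"
proof -
  have bound: "real_of_int c / real w + (- real w) / real (2 * N + 1) \<le>
      real (card (A \<inter> {- int N..int N})) / real (2 * N + 1)" for N :: nat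
  proof -
    define a b where "a = - int N" and "b = int N + 1"
    have ab: "a \<le> b" "b - a = 2 * int N + 1" by (simp_all add: a_def b_def)
    have "c * (2 * int N + 1) = (\<Sum>n\<in>{a..<b}. c)" using ab by simp
    also have "\<dots> \<le> (\<Sum>n\<in>{a..<b}. sum (ind A) {n..<n + int w})"
      using win by (intro sum_mono)
    also have "\<dots> \<le> int w * sum (ind A) {a..<b} + int w * int w"
      using window_sum_bound[of "ind A" a b w] ab by fastforce
    finally have "c * (2 * int N + 1) \<le> int w * int (card (A \<inter> {a..<b})) + int w * int w"
      by (simp add: card_eq_sum_ind)
    moreover have "{a..<b} = {- int N..int N}" by (auto simp: a_def b_def)
    ultimately have "c * (2 * int N + 1) \<le> int w * int (card (A \<inter> {- int N..int N})) + int w * int w" by simp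
    then have "real_of_int (c * (2 * int N + 1)) \<le> real_of_int (int w * int (card (A \<inter> {- int N..int N})) + int w * int w)"
      by (simp only: of_int_le_iff)
    then have h: "real_of_int c * real (2 * N + 1) + real w * (- real w) \<le> real w * real (card (A \<inter> {- int N..int N}))"
      by (simp add: algebra_simps)
    have "real_of_int c / real w + (real w * (- real w) / real w) / real (2 * N + 1) \<le>
        real (card (A \<inter> {- int N..int N})) / real (2 * N + 1)"
      by (rule divide_affine(2)[OF _ _ h]) (use \<open>w > 0\<close> in simp_all)
    then show ?thesis using \<open>w > 0\<close> by simp
  qed
  have "ereal (real_of_int c / real w) = limsup (\<lambda>N. ereal (real_of_int c / real w + (- real w) / real (2 * N + 1)))"
    by (rule lim_imp_Limsup[symmetric]) (simp, rule affine_ratio_tendsto)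
  also have "\<dots> \<le> upper_density A"
    unfolding upper_density_def by (rule Limsup_mono) (use bound in auto)
  finally show ?thesis .
qed

section \<open>Edge and five-cycle inequalities\<close>

text \<open>Independence as linear inequalities over the integers; they force the values
  \<open>0\<close> and \<open>1\<close> and survive reflection and translation.\<close>

definition indep_fn :: "int \<Rightarrow> (int \<Rightarrow> int) \<Rightarrow> bool" where
  "indep_fn k f \<longleftrightarrow> (\<forall>i. 0 \<le> f i \<and> f i + f (i + 1) \<le> 1 \<and> f i + f (i + k) \<le> 1 \<and> f i + f (i + k + 3) \<le> 1)"

text \<open>Adding the five edges bounds twice the sum by \<open>5\<close>; integrality rounds
  down.\<close>

lemma pentagon:
  fixes a :: int
  assumes "a + b \<le> 1" "b + c \<le> 1" "c + d \<le> 1" "d + e \<le> 1" "e + a \<le> 1"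
  shows "a + b + c + d + e \<le> 2"
  using assms by presburger

lemma indep_fnD:
  assumes "indep_fn k f"
  shows "0 \<le> f i" "f i \<le> 1" "j = i + 1 \<or> j = i + k \<or> j = i + k + 3 \<Longrightarrow> f i + f j \<le> 1"
proof -
  have *: "0 \<le> f i \<and> f i + f (i + 1) \<le> 1 \<and> f i + f (i + k) \<le> 1 \<and> f i + f (i + k + 3) \<le> 1" for i
    using assms by (simp add: indep_fn_def)
  show "0 \<le> f i" "f i \<le> 1" "j = i + 1 \<or> j = i + k \<or> j = i + k + 3 \<Longrightarrow> f i + f j \<le> 1"
    using *[of i] *[of "i + 1"] by auto
qed

lemma indep_fn_reflect: "indep_fn k f \<Longrightarrow> indep_fn k (\<lambda>i. f (c - i))"
  unfolding indep_fn_def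
proof (intro allI)
  fix i assume *: "\<forall>i. 0 \<le> f i \<and> f i + f (i + 1) \<le> 1 \<and> f i + f (i + k) \<le> 1 \<and> f i + f (i + k + 3) \<le> 1"
  show "0 \<le> f (c - i) \<and> f (c - i) + f (c - (i + 1)) \<le> 1 \<and> f (c - i) + f (c - (i + k)) \<le> 1
    \<and> f (c - i) + f (c - (i + k + 3)) \<le> 1"
    using *[rule_format, of "c - i"] *[rule_format, of "c - (i + 1)"]
      *[rule_format, of "c - (i + k)"] *[rule_format, of "c - (i + k + 3)"]
    by (simp add: algebra_simps)
qed

lemma indep_fn_translate: "indep_fn k f \<Longrightarrow> indep_fn k (\<lambda>i. f (c + i))"
  unfolding indep_fn_def by (metis (no_types, lifting) add.assoc)

lemma indep_fn_ind:
  assumes "independent_dist {1, k, k + 3} A"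
  shows "indep_fn (int k) (ind A)"
proof -
  have no: "\<not> (i \<in> A \<and> j \<in> A)" if "j = i + 1 \<or> j = i + int k \<or> j = i + int k + 3" for i j
  proof -
    have "nat \<bar>i - j\<bar> \<in> {1, k, k + 3}" using that by auto
    then show ?thesis using assms unfolding independent_dist_def dist_adj_def by blast
  qed
  show ?thesis
    unfolding indep_fn_def
  proof
    fix i
    show "0 \<le> ind A i \<and> ind A i + ind A (i + 1) \<le> 1 \<and> ind A i + ind A (i + int k) \<le> 1 \<and>
        ind A i + ind A (i + int k + 3) \<le> 1"
      using no[of "i + 1" i] no[of "i + int k" i] no[of "i + int k + 3" i] by (simp add: of_bool_def)
  qed
qed

section \<open>Window inequalities\<close>

abbreviation adj :: "int \<Rightarrow> int \<Rightarrow> int \<Rightarrow> bool" where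
  "adj k a b \<equiv> b = a + 1 \<or> b = a + k \<or> b = a + k + 3 \<or> a = b + 1 \<or> a = b + k \<or> a = b + k + 3"

context
  fixes k :: int and f :: "int \<Rightarrow> int"
  assumes k: "k \<ge> 3" and f: "indep_fn k f"
begin

lemma edge:
  assumes "adj k a b"
  shows "f a + f b \<le> 1"
  using assms indep_fnD(3)[OF f, of b a] indep_fnD(3)[OF f, of a b] by (auto simp: add.commute)

lemma five_cycle:
  assumes "adj k a b" "adj k b c" "adj k c d" "adj k d e" "adj k e a"
  shows "f a + f b + f c + f d + f e \<le> 2"
  using edge[OF assms(1)] edge[OF assms(2)] edge[OF assms(3)] edge[OF assms(4)] edge[OF assms(5)]
  by (rule pentagon)

lemma edge_zero:
  assumes "f a = 1" "adj k a b"
  shows "f b = 0"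
  using edge[OF assms(2)] assms(1) indep_fnD(1)[OF f, of b] by simp

text \<open>The first three vertices are neighbours of \<open>0\<close>, the other four of
  \<open>2 * k + 2\<close>.\<close>

lemma corner_zeros:
  assumes "f 0 = 1" "f (2 * k + 2) = 1"
  shows "f k = 0" "f (k + 3) = 0" "f 1 = 0" "f (k + 2) = 0" "f (k - 1) = 0" "f (2 * k + 1) = 0"
    "f (2 * k + 3) = 0"
proof -
  show "f k = 0" "f (k + 3) = 0" "f 1 = 0" by (rule edge_zero[OF assms(1)]; simp)+
  show "f (k + 2) = 0" "f (k - 1) = 0" "f (2 * k + 1) = 0" "f (2 * k + 3) = 0"
    by (rule edge_zero[OF assms(2)]; simp)+
qed

text \<open>Each of the \<open>k + 4\<close> cyclic windows of four consecutive vertices modulo \<open>k + 4\<close>, ending in \<open>j\<close>,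
  forms a five-cycle with \<open>j + k\<close>; the wrapping ones close up because \<open>k + 3\<close> is adjacent to \<open>0\<close>.
  So no boundary term is lost.\<close>
lemma window_transfer_slack:
  assumes "f k + f (k + 1) + f (k + 2) + f (k + 3) + f (2 * k + 3) \<le> z"
  shows "4 * sum f {0..<k + 4} + sum f {k..<2 * k + 4} \<le> 2 * k + 6 + z"
proof -
  \<comment> \<open>The windows starting at \<open>0\<close> to \<open>k - 1\<close>. The one
    starting at \<open>k\<close> is left to the hypothesis, so that its bound can be sharpened from
    \<open>2\<close> to \<open>1\<close>.\<close>
  have "(\<Sum>i\<in>{0..<k}. f i + f (i + 1) + f (i + 2) + f (i + 3) + f (i + (k + 3))) \<le> (\<Sum>i\<in>{0..<k}. 2)"
    by (intro sum_mono five_cycle) auto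
  then have "sum f {0..<k} + sum f {1..<k + 1} + sum f {2..<k + 2} + sum f {3..<k + 3}
      + sum f {k + 3..<2 * k + 3} \<le> 2 * k"
    using k by (simp add: sum.distrib sum_atLeastLessThan_shift_int)
  moreover have "f (k + 1) + f (k + 2) + f (k + 3) + f 0 + f k \<le> 2"
    "f (k + 2) + f (k + 3) + f 0 + f 1 + f (k + 1) \<le> 2"
    "f (k + 3) + f 0 + f 1 + f 2 + f (k + 2) \<le> 2"
    by (rule five_cycle; simp)+
  moreover have "antidiff f 1 = antidiff f 0 + f 0" "antidiff f 2 = antidiff f 1 + f 1"
    "antidiff f 3 = antidiff f 2 + f 2"
    "antidiff f (k + 1) = antidiff f k + f k"
    "antidiff f (k + 2) = antidiff f (k + 1) + f (k + 1)"
    "antidiff f (k + 3) = antidiff f (k + 2) + f (k + 2)"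
    "antidiff f (k + 4) = antidiff f (k + 3) + f (k + 3)"
    "antidiff f (2 * k + 4) = antidiff f (2 * k + 3) + f (2 * k + 3)"
    by (rule antidiff_step; simp)+
  ultimately show ?thesis
    using k assms by (simp add: sum_eq_antidiff)
qed

lemma window_transfer: "4 * sum f {0..<k + 4} + sum f {k..<2 * k + 4} \<le> 2 * k + 8"
proof -
  have "f k + f (k + 1) + f (k + 2) + f (k + 3) + f (2 * k + 3) \<le> 2"
    by (rule five_cycle; simp)
  from window_transfer_slack[OF this] show ?thesis by simp
qed

text \<open>In the five-cycle through \<open>k\<close> to \<open>k + 3\<close> and
  \<open>2 * k + 3\<close> only \<open>k + 1\<close> is occupied, which saves one. The second window
  may move down by one because both exchanged values vanish; the two windows then mirror each other
  inside \<open>{0..<2 * k + 3}\<close>.\<close>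

lemma window_transfer_strict:
  assumes "f 0 = 1" "f (k + 1) = 1" "f (2 * k + 2) = 1"
  shows "4 * sum f {0..<k + 4} + sum f {k - 1..<2 * k + 3} \<le> 2 * k + 7"
proof -
  note z = corner_zeros[OF assms(1,3)]
  have "f k + f (k + 1) + f (k + 2) + f (k + 3) + f (2 * k + 3) \<le> 1"
    using z assms by simp
  from window_transfer_slack[OF this]
  have "4 * sum f {0..<k + 4} + sum f {k..<2 * k + 4} \<le> 2 * k + 7" by simp
  moreover have "sum f {k..<2 * k + 4} = sum f {k - 1..<2 * k + 3}"
    using k z antidiff_step[of "2 * k + 4" "2 * k + 3" f] antidiff_step[of k "k - 1" f]
    by (simp add: sum_eq_antidiff)
  ultimately show ?thesis by simp
qed

text \<open>The \<open>2 * k + 3\<close> five-vertex sums below count each vertex five times and are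
  at most \<open>2\<close> on average.\<close>

lemma long_window:
  assumes "\<not> (f 0 = 1 \<and> f (k + 1) = 1 \<and> f (2 * k + 2) = 1)"
  shows "5 * sum f {0..<2 * k + 3} \<le> 4 * k + 6"
proof -
  \<comment> \<open>Modulo \<open>2k + 3\<close> the sum runs over \<open>2k\<close> five-cycles, of which \<open>p\<close> and \<open>q\<close> are singled
    out, and over three five-vertex paths \<open>r\<close>, \<open>s\<close>, \<open>t\<close>: these miss the edge between
    \<open>2k + 2\<close> and \<open>0\<close>.\<close>
  define p where "p = f (k - 1) + f k + f (k + 1) + f (k + 2) + f (2 * k + 2)"
  define q where "q = f 0 + f k + f (k + 1) + f (k + 2) + f (k + 3)"
  define r where "r = f (2 * k) + f (2 * k + 1) + f (2 * k + 2) + f 0 + f k"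
  define s where "s = f (2 * k + 1) + f (2 * k + 2) + f 0 + f 1 + f (k + 1)"
  define t where "t = f (2 * k + 2) + f 0 + f 1 + f 2 + f (k + 2)"
  have "(\<Sum>i\<in>{0..<k - 1}. f i + f (i + 1) + f (i + 2) + f (i + 3) + f (i + (k + 3))) \<le> (\<Sum>i\<in>{0..<k - 1}. 2)"
    by (intro sum_mono five_cycle) auto
  then have 1: "sum f {0..<k - 1} + sum f {1..<k} + sum f {2..<k + 1} + sum f {3..<k + 2}
      + sum f {k + 3..<2 * k + 2} \<le> 2 * k - 2"
    using k by (simp add: sum.distrib sum_atLeastLessThan_shift_int algebra_simps)
  \<comment> \<open>Mirror images of the previous five-cycles. The omitted indices,
    \<open>k - 1\<close> there and \<open>0\<close> here, give \<open>p\<close> and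
    \<open>q\<close>.\<close>
  have "(\<Sum>i\<in>{1..<k}. f i + f (i + k) + f (i + (k + 1)) + f (i + (k + 2)) + f (i + (k + 3))) \<le> (\<Sum>i\<in>{1..<k}. 2)"
    by (intro sum_mono five_cycle) auto
  then have 2: "sum f {1..<k} + sum f {k + 1..<2 * k} + sum f {k + 2..<2 * k + 1} + sum f {k + 3..<2 * k + 2}
      + sum f {k + 4..<2 * k + 3} \<le> 2 * k - 2"
    using k by (simp add: sum.distrib sum_atLeastLessThan_shift_int algebra_simps)
  have F: "antidiff f 1 = antidiff f 0 + f 0" "antidiff f 2 = antidiff f 1 + f 1"
    "antidiff f 3 = antidiff f 2 + f 2"
    "antidiff f k = antidiff f (k - 1) + f (k - 1)"
    "antidiff f (k + 1) = antidiff f k + f k"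
    "antidiff f (k + 2) = antidiff f (k + 1) + f (k + 1)"
    "antidiff f (k + 3) = antidiff f (k + 2) + f (k + 2)"
    "antidiff f (k + 4) = antidiff f (k + 3) + f (k + 3)"
    "antidiff f (2 * k + 1) = antidiff f (2 * k) + f (2 * k)"
    "antidiff f (2 * k + 2) = antidiff f (2 * k + 1) + f (2 * k + 1)"
    "antidiff f (2 * k + 3) = antidiff f (2 * k + 2) + f (2 * k + 2)"
    by (rule antidiff_step; simp)+
  have total: "5 * sum f {0..<2 * k + 3} \<le> 4 * k - 4 + (p + q + r + s + t)"
    using 1 2 k by (simp add: sum_eq_antidiff p_def q_def r_def s_def t_def F)
  note bnd = indep_fnD(1,2)[OF f]
  have "p \<le> 2" "q \<le> 2" unfolding p_def q_def by (rule five_cycle; simp)+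
  have "p + q + r + s + t \<le> 10"
  proof (cases "f 0 + f (2 * k + 2) \<le> 1")
    case True
    have e: "f 0 + f 1 \<le> 1" "f 0 + f k \<le> 1" "f 1 + f 2 \<le> 1" "f (2 * k) + f (2 * k + 1) \<le> 1"
      "f (2 * k + 1) + f (2 * k + 2) \<le> 1" "f k + f (2 * k) \<le> 1" "f 1 + f (k + 1) \<le> 1"
      "f (k + 1) + f (2 * k + 1) \<le> 1" "f 2 + f (k + 2) \<le> 1" "f (k + 2) + f (2 * k + 2) \<le> 1"
      by (rule edge; simp)+
    \<comment> \<open>\<open>True\<close> stands in for the missing edge and closes the three paths
      to five-cycles.\<close>
    have "r \<le> 2" "s \<le> 2" "t \<le> 2"
      using pentagon[OF e(4,5) _ e(2,6)] pentagon[OF e(5) _ e(1) e(7,8)] pentagon[OF _ e(1,3,9,10)] True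
      unfolding r_def s_def t_def by simp_all
    with \<open>p \<le> 2\<close> \<open>q \<le> 2\<close> show ?thesis by linarith
  next
    case False
    \<comment> \<open>Now \<open>r\<close> and \<open>t\<close> may reach \<open>3\<close>, but the
      hypothesis empties \<open>k + 1\<close>, so \<open>p\<close> and \<open>q\<close> drop to
      \<open>1\<close> and compensate.\<close>
    then have "f 0 = 1" "f (2 * k + 2) = 1" using bnd[of 0] bnd[of "2 * k + 2"] by linarith+
    moreover from this have "f (k + 1) = 0" using assms bnd[of "k + 1"] by linarith
    moreover note corner_zeros[OF \<open>f 0 = 1\<close> \<open>f (2 * k + 2) = 1\<close>]
    ultimately have "p \<le> 1" "q \<le> 1" "r \<le> 3" "s \<le> 2" "t \<le> 3"
      using bnd(2)[of 2] bnd(2)[of "2 * k"] unfolding p_def q_def r_def s_def t_def by simp_all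
    then show ?thesis by linarith
  qed
  with total show ?thesis by linarith
qed

end

text \<open>As \<open>4 * k + 6 = 20 * m + 18\<close>, the averaged bound rounds down to the claim
  outside the exceptional pattern; in that pattern the strict inequality and its mirror image take
  over.\<close>

lemma long_window_le:
  assumes "m \<ge> 0" "k = 5 * m + 3" "indep_fn k f"
  shows "sum f {0..<2 * k + 3} \<le> 4 * m + 3"
proof (cases "f 0 = 1 \<and> f (k + 1) = 1 \<and> f (2 * k + 2) = 1")
  case False
  from long_window[OF _ assms(3) False] assms(1,2) show ?thesis by simp
next
  case True
  have k: "k \<ge> 3" using assms by simp
  define g where "g = (\<lambda>i. f (2 * k + 2 - i))"
  have refl: "sum g {a..<b} = sum f {2 * k + 3 - b..<2 * k + 3 - a}" for a b
    unfolding g_def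
    by (rule sum.reindex_bij_witness[of _ "\<lambda>i. 2 * k + 2 - i" "\<lambda>i. 2 * k + 2 - i"]) auto
  have "indep_fn k g" unfolding g_def by (rule indep_fn_reflect[OF assms(3)])
  then have "4 * sum g {0..<k + 4} + sum g {k - 1..<2 * k + 3} \<le> 2 * k + 7"
    using True by (intro window_transfer_strict k) (auto simp: g_def)
  then have 1: "4 * sum f {k - 1..<2 * k + 3} + sum f {0..<k + 4} \<le> 2 * k + 7"
    by (simp add: refl)
  have 2: "4 * sum f {0..<k + 4} + sum f {k - 1..<2 * k + 3} \<le> 2 * k + 7"
    using window_transfer_strict[OF k assms(3)] True by simp
  note z = corner_zeros[OF k assms(3)]
  have "antidiff f k = antidiff f (k - 1) + f (k - 1)"
    "antidiff f (k + 1) = antidiff f k + f k"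
    "antidiff f (k + 2) = antidiff f (k + 1) + f (k + 1)"
    "antidiff f (k + 3) = antidiff f (k + 2) + f (k + 2)"
    "antidiff f (k + 4) = antidiff f (k + 3) + f (k + 3)"
    by (rule antidiff_step; simp)+
  \<comment> \<open>The two windows overlap in \<open>{k - 1..<k + 4}\<close>, where only
    \<open>k + 1\<close> is occupied.\<close>
  then have "sum f {0..<k + 4} + sum f {k - 1..<2 * k + 3} = sum f {0..<2 * k + 3} + 1"
    using k z True by (auto simp: sum_eq_antidiff)
  \<comment> \<open>Adding the inequalities only gives \<open>x + y \<le> 4 * m + 5\<close>, one too
    many; rounding \<open>x\<close> and \<open>y\<close> separately excludes equality.\<close>
  moreover have "z \<le> 4 * m + 3"
    if "4 * y + x \<le> 2 * k + 7" "4 * x + y \<le> 2 * k + 7" "x + y = z + 1" for x y z :: int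
  proof (rule ccontr)
    assume "\<not> z \<le> 4 * m + 3"
    then have "3 * x \<le> 6 * m + 8" "3 * y \<le> 6 * m + 8" "4 * m + 5 \<le> x + y"
      using that assms(2) by linarith+
    moreover from this have "x \<le> 2 * m + 2" "y \<le> 2 * m + 2" by presburger+
    ultimately show False by linarith
  qed
  ultimately show ?thesis using 1 2 by blast
qed

section \<open>Upper bounds for the density\<close>

lemma sum_translate: "sum (\<lambda>i. f (n + i)) {a..<b} = sum f {n + a..<n + b}" for n :: int
  using sum_atLeastLessThan_shift_int[of f n a b] by (simp add: add.commute)

lemma window_transfer_at:
  assumes "k \<ge> 3" "indep_fn k f"
  shows "4 * sum f {n..<n + (k + 4)} + sum f {n + k..<n + k + (k + 4)} \<le> 2 * k + 8"
  using window_transfer[OF assms(1) indep_fn_translate[OF assms(2)], of n]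
  unfolding sum_translate by (simp add: algebra_simps)

lemma long_window_le_at:
  assumes "m \<ge> 0" "k = 5 * m + 3" "indep_fn k f"
  shows "sum f {n..<n + (2 * k + 3)} \<le> 4 * m + 3"
  using long_window_le[OF assms(1,2) indep_fn_translate[OF assms(3)], of n]
  unfolding sum_translate by simp

lemma upper_bound_short:
  assumes "k \<ge> 3" "independent_dist {1, k, k + 3} A" "2 * int k + 8 = 5 * c + r" "0 \<le> r" "r \<le> 3"
  shows "upper_density A \<le> ereal (real_of_int c / real (k + 4))"
proof -
  define S where "S n = sum (ind A) {n..<n + int (k + 4)}" for n
  have ind: "indep_fn (int k) (ind A)" by (rule indep_fn_ind[OF assms(2)])
  have S0: "0 \<le> S n" for n unfolding S_def by (rule sum_nonneg) simp
  have transfer: "4 * S n + S (n + int k) \<le> 2 * int k + 8" for n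
    using window_transfer_at[OF _ ind, of n] assms(1) unfolding S_def of_nat_add of_nat_numeral by simp
  \<comment> \<open>The potential is the defect of the window count below \<open>c\<close>.\<close>
  show ?thesis
  proof (rule upper_density_le[where \<phi> = "\<lambda>n. max 0 (c - S n)" and C = "max 0 c"])
    fix n
    show "max 0 (c - S n) \<le> max 0 c" "0 \<le> max 0 (c - S n)" using S0[of n] by simp_all
    have "S n \<le> c + max 0 (c - S (n + int k)) - max 0 (c - S n)"
    proof (cases "S n \<le> c")
      case False
      \<comment> \<open>An excess \<open>e \<ge> 1\<close> forces a defect of at least
        \<open>4 * e - r\<close>, which is at least \<open>e\<close> as
        \<open>r \<le> 3\<close>.\<close>
      then have "S n - c \<le> c - S (n + int k)" using transfer[of n] assms(3,5) by linarith
      then have "S n - c \<le> max 0 (c - S (n + int k))" by (rule le_max_iff_disj[THEN iffD2, OF disjI2])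
      moreover have "max 0 (c - S n) = 0" using False by simp
      ultimately show ?thesis by linarith
    qed simp
    then show "sum (ind A) {n..<n + int (k + 4)} \<le> c + max 0 (c - S (n + int k)) - max 0 (c - S n)"
      unfolding S_def .
  qed simp
qed

lemma upper_bound_long:
  assumes "independent_dist {1, k, k + 3} A" "k = 5 * m + 3"
  shows "upper_density A \<le> ereal (real_of_int (4 * int m + 3) / real (2 * k + 3))"
proof (rule upper_density_le[where \<phi> = "\<lambda>_. 0" and C = 0])
  fix n
  have "sum (ind A) {n..<n + (2 * int k + 3)} \<le> 4 * int m + 3"
    by (rule long_window_le_at[OF _ _ indep_fn_ind[OF assms(1)]]) (simp_all add: assms(2))
  then show "sum (ind A) {n..<n + int (2 * k + 3)} \<le> 4 * int m + 3 + 0 - 0"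
    by (simp only: of_nat_add of_nat_mult of_nat_numeral)
qed auto

lemma indep_ratio_eqI:
  assumes "\<And>A. independent_dist S A \<Longrightarrow> upper_density A \<le> d"
    "independent_dist S A" "d \<le> upper_density A"
  shows "indep_ratio S = d"
  unfolding indep_ratio_def using assms by (intro antisym SUP_least SUP_upper2) auto

section \<open>Periodic independent sets\<close>

lemma card_periodic_window:
  fixes q :: int
  assumes "q > 0" "R \<subseteq> {0..<q}"
  shows "sum (ind {x. x mod q \<in> R}) {n..<n + q} = int (card R)"
proof -
  have "bij_betw (\<lambda>x. x mod q) ({x. x mod q \<in> R} \<inter> {n..<n + q}) R"
  \<comment> \<open>The inverse picks the representative of \<open>y\<close> in the window starting
    at \<open>n\<close>.\<close>
  proof (rule bij_betw_byWitness[where f' = "\<lambda>y. n + (y - n) mod q"])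
    show "\<forall>x\<in>{x. x mod q \<in> R} \<inter> {n..<n + q}. n + (x mod q - n) mod q = x"
      by (auto simp: mod_diff_left_eq)
    show "\<forall>y\<in>R. (n + (y - n) mod q) mod q = y"
      using assms by (auto simp: mod_add_right_eq)
    show "(\<lambda>x. x mod q) ` ({x. x mod q \<in> R} \<inter> {n..<n + q}) \<subseteq> R" by auto
    show "(\<lambda>y. n + (y - n) mod q) ` R \<subseteq> {x. x mod q \<in> R} \<inter> {n..<n + q}"
      using assms by (auto simp: mod_add_right_eq subset_iff)
  qed
  then have "card ({x. x mod q \<in> R} \<inter> {n..<n + q}) = card R" by (rule bij_betw_same_card)
  then show ?thesis by (simp only: card_eq_sum_ind[symmetric])
qed

lemma upper_density_periodic_ge:
  assumes "q > 0" "R \<subseteq> {0..<int q}"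
  shows "ereal (real (card R) / real q) \<le> upper_density {x. x mod int q \<in> R}"
  using upper_density_ge[of q "int (card R)" "{x. x mod int q \<in> R}"]
    card_periodic_window[of "int q" R] assms by simp

text \<open>As \<open>d < q\<close>, adding \<open>d\<close> to a residue wraps around at most
  once.\<close>

lemma independent_periodic:
  assumes R: "R \<subseteq> {0..<int q}" and S: "\<And>d. d \<in> S \<Longrightarrow> d < q"
    and no: "\<And>y z d. y \<in> R \<Longrightarrow> z \<in> R \<Longrightarrow> d \<in> S \<Longrightarrow> z \<noteq> y + int d \<and> z \<noteq> y + int d - int q"
  shows "independent_dist S {x. x mod int q \<in> R}"
proof -
  have step: "(x + int d) mod int q \<notin> R" if x: "x mod int q \<in> R" and d: "d \<in> S" for x d
  proof
    define y where "y = x mod int q"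
    assume z: "(x + int d) mod int q \<in> R"
    have y: "0 \<le> y" "y < int q" using x R by (auto simp: y_def)
    have *: "(x + int d) mod int q = (y + int d) mod int q"
      by (simp add: y_def mod_add_left_eq)
    show False
    proof (cases "y + int d < int q")
      case True
      with * y have "(x + int d) mod int q = y + int d" by (simp add: mod_pos_pos_trivial)
      with no[OF x z d] show ?thesis by (simp add: y_def)
    next
      case False
      have "(y + int d) mod int q = (y + int d - int q) mod int q" by (rule minus_mod_self2[symmetric])
      also have "\<dots> = y + int d - int q" using False y S[OF d] by (intro mod_pos_pos_trivial) simp_all
      finally show ?thesis using no[OF x z d] * by (simp add: y_def)
    qed
  qed
  show ?thesis
    unfolding independent_dist_def dist_adj_def
  proof (intro ballI notI)
    fix i j assume ij: "i \<in> {x. x mod int q \<in> R}" "j \<in> {x. x mod int q \<in> R}" "nat \<bar>i - j\<bar> \<in> S"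
    have "i = j + int (nat \<bar>i - j\<bar>) \<or> j = i + int (nat \<bar>i - j\<bar>)" by arith
    then show False using ij step[of i "nat \<bar>i - j\<bar>"] step[of j "nat \<bar>i - j\<bar>"] by auto
  qed
qed

text \<open>Gaps \<open>2\<close> and \<open>3\<close> alternate from \<open>0\<close> up to
  \<open>5 * m\<close>. All differences are \<open>0\<close>, \<open>2\<close> or \<open>3\<close>
  modulo \<open>5\<close>, never \<open>1\<close> or \<open>4\<close>.\<close>

definition five_pattern :: "int \<Rightarrow> int set" where
  "five_pattern m = (\<lambda>t. 5 * t) ` {0..m} \<union> (\<lambda>t. 5 * t + 2) ` {0..<m}"

lemma finite_five_pattern: "finite (five_pattern m)"
  by (simp add: five_pattern_def)

lemma card_five_pattern:
  assumes "m \<ge> 0"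
  shows "card (five_pattern m) = 2 * nat m + 1"
proof -
  have "(\<lambda>t. 5 * t) ` {0..m} \<inter> (\<lambda>t. 5 * t + 2) ` {0..<m} = {}"
    by (auto, presburger)
  moreover have "card ((\<lambda>t. 5 * t) ` {0..m}) = nat m + 1" "card ((\<lambda>t. 5 * t + 2) ` {0..<m}) = nat m"
    using assms by (simp_all add: card_image inj_on_def nat_add_distrib)
  ultimately show ?thesis by (simp add: five_pattern_def card_Un_disjoint)
qed

lemma five_pattern_cases:
  assumes "x \<in> five_pattern m"
  obtains t where "x = 5 * t" "0 \<le> t" "t \<le> m" | t where "x = 5 * t + 2" "0 \<le> t" "t < m"
  using assms by (auto simp: five_pattern_def)

text \<open>Modulo \<open>k + 4\<close> the differences \<open>1\<close>, \<open>k\<close>, \<open>k + 3\<close> become \<open>\<plusminus>1\<close> and \<open>\<plusminus>4\<close>.\<close>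
lemma lower_bound_short:
  assumes "finite E" "E \<inter> five_pattern (int m) = {}" "\<And>x. x \<in> E \<Longrightarrow> 5 * int m \<le> x \<and> x < int k + 4"
    "5 * m < k + 4" "k > 0"
    and no: "\<And>y z d. y \<in> five_pattern (int m) \<union> E \<Longrightarrow> z \<in> five_pattern (int m) \<union> E \<Longrightarrow>
      z - y \<notin> {1, 4, int k, int k + 3}"
  shows "\<exists>A. independent_dist {1, k, k + 3} A \<and>
    ereal (real (2 * m + 1 + card E) / real (k + 4)) \<le> upper_density A"
proof -
  define R where "R = five_pattern (int m) \<union> E"
  have sub: "R \<subseteq> {0..<int (k + 4)}"
    using assms(3,4) unfolding R_def by (fastforce elim: five_pattern_cases)
  have "card R = 2 * m + 1 + card E"
    using assms(1,2) by (simp add: R_def card_Un_disjoint finite_five_pattern card_five_pattern Int_commute)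
  with upper_density_periodic_ge[OF _ sub]
  have "ereal (real (2 * m + 1 + card E) / real (k + 4)) \<le> upper_density {x. x mod int (k + 4) \<in> R}"
    by simp
  moreover have "independent_dist {1, k, k + 3} {x. x mod int (k + 4) \<in> R}"
  proof (rule independent_periodic[OF sub])
    fix y z d assume "y \<in> R" "z \<in> R" and d: "d \<in> {1, k, k + 3}"
    \<comment> \<open>If adding \<open>d\<close> wraps around, \<open>y - z\<close> is
      \<open>k + 3\<close>, \<open>4\<close> or \<open>1\<close>.\<close>
    then have "z - y \<notin> {1, 4, int k, int k + 3}" "y - z \<notin> {1, 4, int k, int k + 3}"
      using no unfolding R_def by blast+
    with d show "z \<noteq> y + int d \<and> z \<noteq> y + int d - int (k + 4)" by auto
  qed (use \<open>k > 0\<close> in auto)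
  ultimately show ?thesis by blast
qed

text \<open>Three gaps of \<open>3\<close> after \<open>5 * m\<close> complete the period
  \<open>5 * m + 9\<close>.\<close>

lemma lower_bound_0:
  assumes "k = 5 * m + 5"
  shows "\<exists>A. independent_dist {1, k, k + 3} A \<and>
    ereal (real (2 * m + 1 + card {5 * int m + 3, 5 * int m + 6}) / real (k + 4)) \<le> upper_density A"
proof (rule lower_bound_short)
  show "{5 * int m + 3, 5 * int m + 6} \<inter> five_pattern (int m) = {}"
    by (auto elim!: five_pattern_cases)
  show "z - y \<notin> {1, 4, int k, int k + 3}"
    if "y \<in> five_pattern (int m) \<union> {5 * int m + 3, 5 * int m + 6}" "z \<in> five_pattern (int m) \<union> {5 * int m + 3, 5 * int m + 6}" for y z
    using that assms by (auto elim!: five_pattern_cases) presburger+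
qed (use assms in auto)

text \<open>The closing gaps \<open>2\<close> and \<open>3\<close> continue the pattern, so the set
  has period \<open>5\<close>.\<close>

lemma lower_bound_1:
  assumes "k = 5 * m + 1" "m > 0"
  shows "\<exists>A. independent_dist {1, k, k + 3} A \<and>
    ereal (real (2 * m + 1 + card {5 * int m + 2}) / real (k + 4)) \<le> upper_density A"
proof (rule lower_bound_short)
  show "{5 * int m + 2} \<inter> five_pattern (int m) = {}"
    by (auto elim!: five_pattern_cases)
  show "z - y \<notin> {1, 4, int k, int k + 3}"
    if "y \<in> five_pattern (int m) \<union> {5 * int m + 2}" "z \<in> five_pattern (int m) \<union> {5 * int m + 2}" for y z
    using that assms by (auto elim!: five_pattern_cases) presburger+
qed (use assms in auto)

text \<open>Two gaps of \<open>3\<close> after \<open>5 * m\<close> complete the period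
  \<open>5 * m + 6\<close>.\<close>

lemma lower_bound_2:
  assumes "k = 5 * m + 2" "m > 0"
  shows "\<exists>A. independent_dist {1, k, k + 3} A \<and>
    ereal (real (2 * m + 1 + card {5 * int m + 3}) / real (k + 4)) \<le> upper_density A"
proof (rule lower_bound_short)
  show "{5 * int m + 3} \<inter> five_pattern (int m) = {}"
    by (auto elim!: five_pattern_cases)
  show "z - y \<notin> {1, 4, int k, int k + 3}"
    if "y \<in> five_pattern (int m) \<union> {5 * int m + 3}" "z \<in> five_pattern (int m) \<union> {5 * int m + 3}" for y z
    using that assms by (auto elim!: five_pattern_cases) presburger+
qed (use assms in auto)

text \<open>The pattern runs to \<open>5 * m + 5\<close>, and a single gap of \<open>3\<close>
  closes the period \<open>5 * m + 8\<close>.\<close>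

lemma lower_bound_4:
  assumes "k = 5 * m + 4"
  shows "\<exists>A. independent_dist {1, k, k + 3} A \<and>
    ereal (real (2 * Suc m + 1 + card ({} :: int set)) / real (k + 4)) \<le> upper_density A"
proof (rule lower_bound_short)
  show "z - y \<notin> {1, 4, int k, int k + 3}"
    if "y \<in> five_pattern (int (Suc m)) \<union> {}" "z \<in> five_pattern (int (Suc m)) \<union> {}" for y z
    using that assms by (auto elim!: five_pattern_cases) presburger+
qed (use assms in auto)

text \<open>The pattern is mirrored about \<open>5 * m + 2\<close>, which belongs to both halves.
  Residues modulo \<open>5\<close> are \<open>0\<close>, \<open>2\<close> in the lower half and
  \<open>2\<close>, \<open>4\<close> in the upper one. A positive difference is never
  \<open>1\<close> modulo \<open>5\<close>, and it is \<open>3\<close> only within one half, hence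
  at most \<open>5 * m + 2\<close>.\<close>

lemma lower_bound_3:
  assumes "k = 5 * m + 3"
  shows "\<exists>A. independent_dist {1, k, k + 3} A \<and>
    ereal (real (4 * m + 3) / real (2 * k + 3)) \<le> upper_density A"
proof -
  define T where "T = (\<lambda>x. 10 * int m + 4 - x) ` five_pattern (int m)"
  define R where "R = insert (5 * int m + 2) (five_pattern (int m) \<union> T)"
  have sub: "R \<subseteq> {0..<int (2 * k + 3)}"
    using assms by (auto simp: R_def T_def elim!: five_pattern_cases)
  have "five_pattern (int m) \<inter> T = {}" "5 * int m + 2 \<notin> five_pattern (int m) \<union> T"
    by (auto simp: T_def elim!: five_pattern_cases)
  moreover have "card T = 2 * m + 1"
    unfolding T_def by (subst card_image) (simp_all add: inj_on_def card_five_pattern)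
  ultimately have "card R = 4 * m + 3"
    by (simp add: R_def card_Un_disjoint finite_five_pattern card_five_pattern T_def)
  with upper_density_periodic_ge[OF _ sub]
  have "ereal (real (4 * m + 3) / real (2 * k + 3)) \<le> upper_density {x. x mod int (2 * k + 3) \<in> R}"
    by simp
  moreover have "independent_dist {1, k, k + 3} {x. x mod int (2 * k + 3) \<in> R}"
  proof (rule independent_periodic[OF sub])
    have cl: "0 \<le> x \<and> x \<le> 5 * int m + 2 \<and> (x mod 5 = 0 \<or> x mod 5 = 2) \<or>
        5 * int m + 2 \<le> x \<and> x \<le> 10 * int m + 4 \<and> (x mod 5 = 2 \<or> x mod 5 = 4)"
      if x: "x \<in> R" for x
    proof -
      have "x = 5 * int m + 2 \<or> x \<in> five_pattern (int m) \<or> (\<exists>y\<in>five_pattern (int m). x = 10 * int m + 4 - y)"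
        using x by (auto simp: R_def T_def)
      moreover have "(10 * int m + 4 - 5 * t) mod 5 = 4" "(10 * int m + 4 - (5 * t + 2)) mod 5 = 2" for t
        by presburger+
      ultimately show ?thesis by (auto elim!: five_pattern_cases)
    qed
    have no: "z - y \<notin> {1, int k, int k + 3, 2 * int k + 2}" if yz: "y \<in> R" "z \<in> R" for y z
    proof
      assume "z - y \<in> {1, int k, int k + 3, 2 * int k + 2}"
      \<comment> \<open>Each forbidden difference is \<open>1\<close> modulo \<open>5\<close>, or
        \<open>3\<close> modulo \<open>5\<close> and longer than a half.\<close>
      then have "z - y = 5 * 0 + 1 \<or> z - y = 5 * int m + 3 \<or> z - y = 5 * (int m + 1) + 1 \<or>
          z - y = 5 * (2 * int m + 1) + 3"
        using assms by auto
      then obtain c where "c \<ge> 0" "z - y = 5 * c + 1 \<or> z - y = 5 * c + 3 \<and> c \<ge> int m"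
        using that[of 0] that[of "int m"] that[of "int m + 1"] that[of "2 * int m + 1"] by auto
      then have "z - y > 0" and "(z - y) mod 5 = 1 \<or> (z - y) mod 5 = 3 \<and> z - y > 5 * int m + 2"
        by auto
      moreover have "(z - y) mod 5 = (z mod 5 - y mod 5) mod 5" by (simp add: mod_diff_eq)
      ultimately show False using cl[OF yz(1)] cl[OF yz(2)] by (elim disjE conjE) simp_all
    qed
    show "z \<noteq> y + int d \<and> z \<noteq> y + int d - int (2 * k + 3)"
      if "y \<in> R" "z \<in> R" "d \<in> {1, k, k + 3}" for y z d
      using no[OF that(1,2)] no[OF that(2,1)] that(3) by auto
  qed (use assms in auto)
  ultimately show ?thesis by blast
qed

theorem theorem36:
  fixes k :: nat
  assumes "k \<ge> 3"
  shows "indep_ratio {1, k, k + 3} =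
    ereal (if k mod 5 = 0 then (2 * real k + 5) / (5 * real k + 20)
      else if k mod 5 = 1 then 2 / 5
      else if k mod 5 = 2 then (2 * real k + 6) / (5 * real k + 20)
      else if k mod 5 = 3 then (4 * real k + 3) / (10 * real k + 15)
      else (2 * real k + 7) / (5 * real k + 20))"
proof -
  \<comment> \<open>Common form of all cases but residue \<open>3\<close>; \<open>r\<close> is the
    remainder of \<open>2 * k + 8\<close> modulo \<open>5\<close>.\<close>
  have short: "indep_ratio {1, k, k + 3} = ereal ((2 * real k + 8 - real r) / (5 * real k + 20))"
    if low: "\<exists>A. independent_dist {1, k, k + 3} A \<and> ereal (real c / real (k + 4)) \<le> upper_density A"
      and c: "2 * k + 8 = 5 * c + r" and "r \<le> 3" for c r
  proof -
    have "indep_ratio {1, k, k + 3} = ereal (real c / real (k + 4))"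
      using low upper_bound_short[OF assms, of _ "int c" "int r"] c \<open>r \<le> 3\<close>
      by (auto intro: indep_ratio_eqI)
    also have "real c / real (k + 4) = (5 * real c) / (5 * real (k + 4))"
      by (rule mult_divide_mult_cancel_left[symmetric]) simp
    also have "5 * real c = 2 * real k + 8 - real r" using c by linarith
    also have "5 * real (k + 4) = 5 * real k + 20" by simp
    finally show ?thesis .
  qed
  define m where "m = k div 5"
  have k: "k = 5 * m + k mod 5" by (simp add: m_def)
  have "k mod 5 < 5" by simp
  then consider "k mod 5 = 0" | "k mod 5 = 1" | "k mod 5 = 2" | "k mod 5 = 3" | "k mod 5 = 4" by linarith
  then show ?thesis
  proof cases
    case 1
    \<comment> \<open>\<open>k \<ge> 3\<close> excludes \<open>m = 0\<close>; the construction here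
      is indexed by \<open>k = 5 * n + 5\<close>.\<close>
    then obtain n where n: "m = Suc n" using k assms by (cases m) auto
    have "k = 5 * n + 5" using k 1 n by simp
    then show ?thesis using short[OF lower_bound_0, of n 3] 1 by simp
  next
    case 2
    then have km: "k = 5 * m + 1" using k by simp
    then have "indep_ratio {1, k, k + 3} = ereal ((2 * real k + 8) / (5 * real k + 20))"
      using short[OF lower_bound_1, of m 0] assms by simp
    also have "(2 * real k + 8) / (5 * real k + 20) = 2 / 5" by (simp add: divide_simps)
    finally show ?thesis using 2 by simp
  next
    case 3
    then have "k = 5 * m + 2" using k by simp
    then show ?thesis using short[OF lower_bound_2, of m 2] assms 3 by simp
  next
    case 4
    then have km: "k = 5 * m + 3" using k by simp
    have "indep_ratio {1, k, k + 3} = ereal (real (4 * m + 3) / real (2 * k + 3))"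
      using lower_bound_3[OF km] upper_bound_long[OF _ km] by (auto intro: indep_ratio_eqI)
    also have "real (4 * m + 3) / real (2 * k + 3) = (5 * real (4 * m + 3)) / (5 * real (2 * k + 3))"
      by (rule mult_divide_mult_cancel_left[symmetric]) simp
    also have "5 * real (4 * m + 3) = 4 * real k + 3" using km by simp
    also have "5 * real (2 * k + 3) = 10 * real k + 15" by simp
    finally show ?thesis using 4 by simp
  next
    case 5
    then have "k = 5 * m + 4" using k by simp
    then show ?thesis using short[OF lower_bound_4, of m 1] 5 by simp
  qed
qed

end
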